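(* Let $r,k$ be integers that are coprime with $1\le k<r/3$, and let $A$ satisfy $\{0,k\}\subseteq A\subseteq[0,k]\subseteq\mathbb{Z}/r\mathbb{Z}$. Then: (1) If $(W,R)$ is Frame 1 and $w_0=x$, then $(W,R)$ is an impossibility frame under $\Gamma=\{\Box^jp,\lnot\Box^jp\}_{j\ge1}$. (2) If $(W,R)$ is Frame 2, $A$ is $k$-symmetric, and $w_0=0$, then $(W,R)$ is an impossibility frame under $\Gamma=\{(\Box\Diamond)^j\Box p,\lnot(\Box\Diamond)^j\Box p\}_{j\ge0}$.
   Context: For integers $a\le b$, $[a,b]=\{\overline a,\overline{a+1},\dots,\overline b\}\subseteq\mathbb{Z}/r\mathbb{Z}$. Frame 1: $W=\{x\}\sqcup\mathbb{Z}/r\mathbb{Z}$, $R=\{(x,a)\mid a\in A\}\sqcup\{(w,w+k)\mid w\in\mathbb{Z}/r\mathbb{Z}\}$. Frame 2: $W=\mathbb{Z}/r\mathbb{Z}$, $R=\{(w,w+a)\mid w\in\mathbb{Z}/r\mathbb{Z},a\in A\}$. $A$ is $k$-symmetric if $k-a\in A$ for all $a\in A$. Formulas are built from one variable $p$ with $\Box,\Diamond,\lnot$ under standard Kripke semantics ($w:p$ iff $w\in V$; $\Box$: all $R$-successors; $\Diamond$: some $R$-successor; $\lnot$: classical negation), with $\lnot\lnot\Phi$ identified with $\Phi$. For the fixed frame and world $w_0$: $\Gamma_0\subseteq\Gamma$ is consistent if some valuation $V\subseteq W$ makes every formula of $\Gamma_0$ true at $w_0$. $\Delta\subseteq\Gamma$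 is minimally inconsistent if for all $\Delta_0\subseteq\Delta$, $\Delta_0$ is inconsistent iff $\Delta_0=\Delta$. $\Gamma$ is minimally connected if some $\Gamma_0\subseteq\Gamma$ with $|\Gamma_0|\ge3$ is minimally inconsistent. For negation-free $\Phi,\Psi\in\Gamma$, $\Phi<_0\Psi$ means there is $\Gamma_0\subseteq\Gamma$ with $\Gamma_0\cup\{\Phi,\lnot\Psi\}$ minimally inconsistent and $\Gamma_0\cup\{\lnot\Phi,\Psi\}$ consistent. $\Gamma$ is strongly path-connected if for all negation-free $\Phi,\Psi\in\Gamma$ there is a chain $\Phi=\Phi_0<_0\Phi_1<_0\dots<_0\Phi_m=\Psi$. $(W,R)$ is an impossibility frame under $\Gamma$ if $\Gamma$ is minimally connected and strongly path-connected. *)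

theory Defs
  imports "HOL-Number_Theory.Residues"
begin

text \<open>
  Formulas in which \<open>\<not>\<not>\<Phi>\<close> is identified with \<open>\<Phi>\<close>, also inside other formulas:
  a \<^emph>\<open>core\<close> is a formula whose outermost symbol is not a negation, and a formula is a core
  or a negated core, so each value is the normal form of exactly one identification class.
\<close>

datatype form = Plain core | Negated core
and core = VarC | BoxC form | DiaC form

definition Var :: form where
  "Var = Plain VarC"

definition Box :: "form \<Rightarrow> form" where
  "Box \<Phi> = Plain (BoxC \<Phi>)"

definition Dia :: "form \<Rightarrow> form" where
  "Dia \<Phi> = Plain (DiaC \<Phi>)"

primrec neg :: "form \<Rightarrow> form" where
  "neg (Plain c) = Negated c"
| "neg (Negated c) = Plain c"

primrec negation_free :: "form \<Rightarrow> bool"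
    and negation_free_core :: "core \<Rightarrow> bool" where
  "negation_free (Plain c) \<longleftrightarrow> negation_free_core c"
| "negation_free (Negated c) \<longleftrightarrow> False"
| "negation_free_core VarC \<longleftrightarrow> True"
| "negation_free_core (BoxC \<Phi>) \<longleftrightarrow> negation_free \<Phi>"
| "negation_free_core (DiaC \<Phi>) \<longleftrightarrow> negation_free \<Phi>"

primrec sat :: "'w set \<Rightarrow> ('w \<times> 'w) set \<Rightarrow> 'w set \<Rightarrow> form \<Rightarrow> 'w \<Rightarrow> bool"
    and sat_core :: "'w set \<Rightarrow> ('w \<times> 'w) set \<Rightarrow> 'w set \<Rightarrow> core \<Rightarrow> 'w \<Rightarrow> bool" where
  "sat W R V (Plain c) = (\<lambda>w. sat_core W R V c w)"
| "sat W R V (Negated c) = (\<lambda>w. \<not> sat_core W R V c w)"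
| "sat_core W R V VarC = (\<lambda>w. w \<in> V)"
| "sat_core W R V (BoxC \<Phi>) = (\<lambda>w. \<forall>v\<in>W. (w, v) \<in> R \<longrightarrow> sat W R V \<Phi> v)"
| "sat_core W R V (DiaC \<Phi>) = (\<lambda>w. \<exists>v\<in>W. (w, v) \<in> R \<and> sat W R V \<Phi> v)"

lemma sat_simps:
  "sat W R V Var w \<longleftrightarrow> w \<in> V"
  "sat W R V (Box \<Phi>) w \<longleftrightarrow> (\<forall>v\<in>W. (w, v) \<in> R \<longrightarrow> sat W R V \<Phi> v)"
  "sat W R V (Dia \<Phi>) w \<longleftrightarrow> (\<exists>v\<in>W. (w, v) \<in> R \<and> sat W R V \<Phi> v)"
  "sat W R V (neg \<Phi>) w \<longleftrightarrow> \<not> sat W R V \<Phi> w"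
  by (cases \<Phi>; simp add: Var_def Box_def Dia_def)+

definition consistent :: "'w set \<Rightarrow> ('w \<times> 'w) set \<Rightarrow> 'w \<Rightarrow> form set \<Rightarrow> bool" where
  "consistent W R w0 \<Gamma>0 \<longleftrightarrow> (\<exists>V\<subseteq>W. \<forall>\<Phi>\<in>\<Gamma>0. sat W R V \<Phi> w0)"

text \<open>
  The requirement that the sets lie in \<open>\<Gamma>\<close> is imposed where the notions are used; for
  \<open>\<Gamma>\<close> closed under \<open>neg\<close> it then holds for all sets that occur.
\<close>

definition minimally_inconsistent :: "'w set \<Rightarrow> ('w \<times> 'w) set \<Rightarrow> 'w \<Rightarrow> form set \<Rightarrow> bool" where
  "minimally_inconsistent W R w0 \<Delta> \<longleftrightarrow>
     (\<forall>\<Delta>0\<subseteq>\<Delta>. \<not> consistent W R w0 \<Delta>0 \<longleftrightarrow> \<Delta>0 = \<Delta>)"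

text \<open>Since \<open>card\<close> is \<open>0\<close> on infinite sets, \<open>|\<Gamma>0| \<ge> 3\<close> includes the infinite case explicitly.\<close>

definition minimally_connected :: "'w set \<Rightarrow> ('w \<times> 'w) set \<Rightarrow> 'w \<Rightarrow> form set \<Rightarrow> bool" where
  "minimally_connected W R w0 \<Gamma> \<longleftrightarrow>
     (\<exists>\<Gamma>0\<subseteq>\<Gamma>. (infinite \<Gamma>0 \<or> card \<Gamma>0 \<ge> 3) \<and> minimally_inconsistent W R w0 \<Gamma>0)"

definition path_step ::
  "'w set \<Rightarrow> ('w \<times> 'w) set \<Rightarrow> 'w \<Rightarrow> form set \<Rightarrow> form \<Rightarrow> form \<Rightarrow> bool" where
  "path_step W R w0 \<Gamma> \<Phi> \<Psi> \<longleftrightarrow>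
     \<Phi> \<in> \<Gamma> \<and> negation_free \<Phi> \<and> \<Psi> \<in> \<Gamma> \<and> negation_free \<Psi> \<and>
     (\<exists>\<Gamma>0\<subseteq>\<Gamma>. minimally_inconsistent W R w0 (\<Gamma>0 \<union> {\<Phi>, neg \<Psi>}) \<and>
             consistent W R w0 (\<Gamma>0 \<union> {neg \<Phi>, \<Psi>}))"

definition strongly_path_connected :: "'w set \<Rightarrow> ('w \<times> 'w) set \<Rightarrow> 'w \<Rightarrow> form set \<Rightarrow> bool" where
  "strongly_path_connected W R w0 \<Gamma> \<longleftrightarrow>
     (\<forall>\<Phi>\<in>\<Gamma>. \<forall>\<Psi>\<in>\<Gamma>. negation_free \<Phi> \<longrightarrow> negation_free \<Psi> \<longrightarrow>
        (path_step W R w0 \<Gamma>)\<^sup>*\<^sup>* \<Phi> \<Psi>)"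

definition impossibility_frame :: "'w set \<Rightarrow> ('w \<times> 'w) set \<Rightarrow> 'w \<Rightarrow> form set \<Rightarrow> bool" where
  "impossibility_frame W R w0 \<Gamma> \<longleftrightarrow>
     minimally_connected W R w0 \<Gamma> \<and> strongly_path_connected W R w0 \<Gamma>"

text \<open>
  The carrier of \<open>residue_ring r\<close> is \<open>{0..r - 1}\<close>: the class of an integer is its
  representative in this range.
\<close>

definition residue_class :: "int \<Rightarrow> int \<Rightarrow> int" where
  "residue_class r c = c mod r"

definition residue_interval :: "int \<Rightarrow> int \<Rightarrow> int \<Rightarrow> int set" where
  "residue_interval r a b = residue_class r ` {a..b}"

definition k_symmetric :: "int \<Rightarrow> int \<Rightarrow> int set \<Rightarrow> bool" where
  "k_symmetric r k A \<longleftrightarrow> (\<forall>a\<in>A. residue_class r k \<ominus>\<^bsub>residue_ring r\<^esub> a \<in> A)"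

text \<open>In the first frame \<open>None\<close> is the extra world \<open>x\<close>.\<close>

definition worlds1 :: "int \<Rightarrow> int option set" where
  "worlds1 r = insert None (Some ` carrier (residue_ring r))"

definition rel1 :: "int \<Rightarrow> int \<Rightarrow> int set \<Rightarrow> (int option \<times> int option) set" where
  "rel1 r k A = {(None, Some a) | a. a \<in> A} \<union>
     {(Some w, Some (w \<oplus>\<^bsub>residue_ring r\<^esub> residue_class r k)) | w. w \<in> carrier (residue_ring r)}"

definition worlds2 :: "int \<Rightarrow> int set" where
  "worlds2 r = carrier (residue_ring r)"

definition rel2 :: "int \<Rightarrow> int set \<Rightarrow> (int \<times> int) set" where
  "rel2 r A = {(w, w \<oplus>\<^bsub>residue_ring r\<^esub> a) | w a. w \<in> carrier (residue_ring r) \<and> a \<in> A}"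

definition agenda1 :: "form set" where
  "agenda1 = (\<Union>j\<in>{1..}. {(Box ^^ j) Var, neg ((Box ^^ j) Var)})"

definition agenda2 :: "form set" where
  "agenda2 = (\<Union>j. {((Box \<circ> Dia) ^^ j) (Box Var), neg (((Box \<circ> Dia) ^^ j) (Box Var))})"

end

theory Submission
  imports Defs
begin

text \<open>
  In both frames the \<open>j\<close>-th formula of the agenda says that the translate \<open>A + jk\<close> is contained
  in \<open>V\<close>; in the second frame because, by \<open>k\<close>-symmetry, \<open>\<diamond>\<close> is a shift by \<open>-k\<close> of the dilation
  adjoint to the erosion \<open>\<box>\<close>. So minimally inconsistent sets come from minimal covers of one
  translate by others. The translates \<open>A + k\<close> and \<open>A + a - k\<close>, for \<open>a \<in> A - {k}\<close>, cover \<open>A\<close>; only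
  the first one contains \<open>k\<close>, and \<open>2k\<close> lies in none of the others nor in \<open>A\<close>, because \<open>3k < r\<close>. Hence
  each translate by \<open>(j + 1)k\<close> precedes the translate by \<open>jk\<close>, and these steps run cyclically
  through all residues.
\<close>

section \<open>Minimal covers and agendas whose formulas are inclusions\<close>

lemma finite_minimal_subset:
  assumes "finite T" "P T"
  obtains S where "S \<subseteq> T" "P S" "\<And>s. s \<in> S \<Longrightarrow> \<not> P (S - {s})"
proof -
  have "\<exists>S\<subseteq>T. P S \<and> (\<forall>s\<in>S. \<not> P (S - {s}))"
    using assms
  proof (induction T rule: finite_psubset_induct)
    case (psubset T)
    show ?case
    proof (cases "\<exists>s\<in>T. P (T - {s})")
      case True
      then obtain s where s: "s \<in> T" "P (T - {s})" by blast
      then have "T - {s} \<subset> T" by blast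
      from psubset.IH[OF this s(2)] show ?thesis by blast
    next
      case False
      then show ?thesis using psubset.prems by blast
    qed
  qed
  then show thesis using that by blast
qed

text \<open>Common form of both frames: a formula sees \<open>V\<close> only through one inclusion,
  so consistency at \<open>w0\<close> becomes a question about which of the sets \<open>B j\<close>
  cover which others.\<close>

locale inclusion_agenda =
  fixes W :: "'w set" and R :: "('w \<times> 'w) set" and w0 :: 'w
    and \<phi> :: "nat \<Rightarrow> form" and B :: "nat \<Rightarrow> 'w set"
  assumes sat_iff: "\<And>V j. V \<subseteq> W \<Longrightarrow> sat W R V (\<phi> j) w0 \<longleftrightarrow> B j \<subseteq> V"
    and B_subset: "\<And>j. B j \<subseteq> W"
    and neg_free: "\<And>j. negation_free (\<phi> j)"
begin

definition agenda :: "form set" where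
  "agenda = (\<Union>j. {\<phi> j, neg (\<phi> j)})"

lemma not_negation_free_neg: "\<not> negation_free (neg (\<phi> j))"
  using neg_free[of j] by (cases "\<phi> j") auto

text \<open>Truth of all \<open>\<phi> s\<close> with \<open>s\<close> in \<open>S\<close> forces
  \<open>V\<close> to contain the union of the \<open>B s\<close>, hence \<open>B i\<close>. A
  proper subset has a model: \<open>W\<close> if the negation is missing, and the union of the other
  sets if some \<open>\<phi> s\<close> is missing.\<close>

lemma minimally_inconsistentI:
  assumes cover: "B i \<subseteq> \<Union> (B ` S)"
    and min: "\<And>s. s \<in> S \<Longrightarrow> \<not> B i \<subseteq> \<Union> (B ` (S - {s}))"
  shows "minimally_inconsistent W R w0 (\<phi> ` S \<union> {neg (\<phi> i)})"
proof -
  have "\<not> consistent W R w0 (\<phi> ` S \<union> {neg (\<phi> i)})"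
    using cover unfolding consistent_def by (auto simp: sat_iff sat_simps)
  moreover have "consistent W R w0 \<Delta>"
    if \<Delta>: "\<Delta> \<subseteq> \<phi> ` S \<union> {neg (\<phi> i)}" "\<Delta> \<noteq> \<phi> ` S \<union> {neg (\<phi> i)}" for \<Delta>
  proof (cases "neg (\<phi> i) \<in> \<Delta>")
    case False
    then have "\<Delta> \<subseteq> \<phi> ` S" using \<Delta> by blast
    then have "\<forall>\<Phi>\<in>\<Delta>. sat W R W \<Phi> w0"
      using B_subset by (auto simp: sat_iff)
    then show ?thesis unfolding consistent_def by blast
  next
    case True
    then obtain s where s: "s \<in> S" "\<phi> s \<notin> \<Delta>" using \<Delta> by blast
    let ?V = "\<Union> (B ` (S - {s}))"
    have V: "?V \<subseteq> W" using B_subset by blast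
    have "sat W R ?V \<Phi> w0" if "\<Phi> \<in> \<Delta>" for \<Phi>
    proof (cases "\<Phi> = neg (\<phi> i)")
      case True
      then show ?thesis using min[OF s(1)] by (simp add: sat_simps sat_iff[OF V])
    next
      case False
      then obtain t where "t \<in> S" "\<Phi> = \<phi> t" using \<open>\<Phi> \<in> \<Delta>\<close> \<Delta> by blast
      moreover from this have "t \<noteq> s" using s \<open>\<Phi> \<in> \<Delta>\<close> by blast
      ultimately show ?thesis using sat_iff[OF V, of t] by blast
    qed
    with V show ?thesis unfolding consistent_def by blast
  qed
  ultimately show ?thesis unfolding minimally_inconsistent_def by blast
qed

text \<open>Each point has one task. Only \<open>B j\<close> covers \<open>p\<close>, so
  \<open>j\<close> survives in every subcover of \<open>B i\<close>. The point \<open>q\<close>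
  keeps \<open>B j\<close> outside \<open>B i\<close> and the rest of the cover, so
  \<open>\<phi> j\<close> and \<open>\<phi> i\<close> can swap truth values. The point
  \<open>z\<close> forces a member of \<open>T\<close> into the subcover, which gives a third
  formula.\<close>

lemma path_step_and_connected:
  assumes fin: "finite T"
    and cover: "B i \<subseteq> B j \<union> \<Union> (B ` T)"
    and p: "p \<in> B i" "p \<in> B j" "p \<notin> \<Union> (B ` T)"
    and q: "q \<in> B j" "q \<notin> B i" "q \<notin> \<Union> (B ` T)"
    and z: "z \<in> B i" "z \<notin> B j"
  shows "path_step W R w0 agenda (\<phi> j) (\<phi> i)" "minimally_connected W R w0 agenda"
proof -
  have "finite (insert j T)" "B i \<subseteq> \<Union> (B ` insert j T)" using fin cover by auto
  then obtain S where S: "S \<subseteq> insert j T" "B i \<subseteq> \<Union> (B ` S)"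
    and min: "\<And>s. s \<in> S \<Longrightarrow> \<not> B i \<subseteq> \<Union> (B ` (S - {s}))"
    by (rule finite_minimal_subset[where P = "\<lambda>S. B i \<subseteq> \<Union> (B ` S)"]) auto
  have mi: "minimally_inconsistent W R w0 (\<phi> ` S \<union> {neg (\<phi> i)})"
    using minimally_inconsistentI S(2) min by blast
  have jS: "j \<in> S" using S p by blast
  \<comment> \<open>This is the least valuation that makes \<open>\<phi> i\<close> and the remaining
    formulas of the cover true; it misses \<open>q\<close>.\<close>
  let ?V = "B i \<union> \<Union> (B ` (S - {j}))"
  have V: "?V \<subseteq> W" using B_subset by blast
  have "\<not> B j \<subseteq> ?V" using q S(1) by blast
  then have "\<forall>\<Phi> \<in> \<phi> ` (S - {j}) \<union> {neg (\<phi> j), \<phi> i}. sat W R ?V \<Phi> w0"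
    by (auto simp: sat_simps sat_iff[OF V])
  then have "consistent W R w0 (\<phi> ` (S - {j}) \<union> {neg (\<phi> j), \<phi> i})"
    using V unfolding consistent_def by blast
  moreover have "\<phi> ` (S - {j}) \<union> {\<phi> j, neg (\<phi> i)} = \<phi> ` S \<union> {neg (\<phi> i)}"
    using jS by blast
  ultimately show "path_step W R w0 agenda (\<phi> j) (\<phi> i)"
    unfolding path_step_def using mi neg_free
    by (intro conjI exI[of _ "\<phi> ` (S - {j})"]) (auto simp: agenda_def)
  obtain s where s: "s \<in> S" "z \<in> B s" using S z by blast
  then have "s \<in> T" using S z by blast
  then have "\<not> B j \<subseteq> B s" using p by blast
  \<comment> \<open>The valuation \<open>B s\<close> separates the two formulas: it makes
    \<open>\<phi> s\<close> true and \<open>\<phi> j\<close> false.\<close>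
  then have "\<phi> j \<noteq> \<phi> s" using sat_iff[OF B_subset[of s]] by (metis order_refl)
  moreover have "neg (\<phi> i) \<noteq> \<phi> j" "neg (\<phi> i) \<noteq> \<phi> s"
    using not_negation_free_neg neg_free by metis+
  ultimately have "card {\<phi> j, \<phi> s, neg (\<phi> i)} = 3" by auto
  moreover have "finite (\<phi> ` S \<union> {neg (\<phi> i)})"
    using S(1) fin by (meson finite_Un finite_imageI finite_insert finite.emptyI finite_subset)
  ultimately have "card (\<phi> ` S \<union> {neg (\<phi> i)}) \<ge> 3"
    using card_mono[of "\<phi> ` S \<union> {neg (\<phi> i)}" "{\<phi> j, \<phi> s, neg (\<phi> i)}"] jS s by auto
  with mi show "minimally_connected W R w0 agenda"
    unfolding minimally_connected_def
    by (intro exI[of _ "\<phi> ` S \<union> {neg (\<phi> i)}"]) (auto simp: agenda_def)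
qed

text \<open>Single steps descend from any index to 0. From 0 a step leads up to arbitrarily large
  indices, because indices only matter modulo \<open>r\<close>, and descent from there reaches every
  target.\<close>

lemma strongly_path_connected_if_cyclic_steps:
  assumes r: "r > 0"
    and step: "\<And>i j. int j mod r = (int i + 1) mod r \<Longrightarrow>
      path_step W R w0 agenda (\<phi> j) (\<phi> i)"
  shows "strongly_path_connected W R w0 agenda"
proof -
  let ?step = "path_step W R w0 agenda"
  have descend: "?step\<^sup>*\<^sup>* (\<phi> (i + n)) (\<phi> i)" for i n
  proof (induction n)
    case (Suc n)
    have "?step (\<phi> (i + Suc n)) (\<phi> (i + n))" by (rule step) (simp add: algebra_simps)
    then show ?case using Suc by simp
  qed simp
  have "?step\<^sup>*\<^sup>* (\<phi> j) (\<phi> i)" for i j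
  proof -
    have "?step\<^sup>*\<^sup>* (\<phi> j) (\<phi> 0)" using descend[of 0 j] by simp
    \<comment> \<open>\<open>(i + 1) r - 1\<close> is an index \<open>\<ge> i\<close> congruent to \<open>-1\<close>, so \<open>0\<close> is its successor modulo \<open>r\<close>.\<close>
    moreover define M where "M = nat ((int i + 1) * r - 1)"
    have ge: "(int i + 1) * r \<ge> int i + 1"
      using r mult_left_mono[of 1 r "int i + 1"] by simp
    then have M: "int M = (int i + 1) * r - 1" "M \<ge> i" unfolding M_def by linarith+
    have "?step (\<phi> 0) (\<phi> M)" by (rule step) (simp add: M)
    moreover have "?step\<^sup>*\<^sup>* (\<phi> M) (\<phi> i)" using descend[of i "M - i"] M by simp
    ultimately show ?thesis by (meson rtranclp.rtrancl_into_rtrancl rtranclp_trans)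
  qed
  then show ?thesis
    unfolding strongly_path_connected_def agenda_def using not_negation_free_neg by blast
qed

end

section \<open>Translates of \<open>A\<close> modulo \<open>r\<close>\<close>

definition translate :: "int \<Rightarrow> int set \<Rightarrow> int \<Rightarrow> int set" where
  "translate r A t = (\<lambda>a. (a + t) mod r) ` A"

lemma translate_subset: "r > 0 \<Longrightarrow> translate r A t \<subseteq> {0..<r}"
  by (auto simp: translate_def)

lemma translate_cong:
  assumes "s mod r = t mod r"
  shows "translate r A s = translate r A t"
  unfolding translate_def using assms by (intro image_cong) (auto intro: mod_add_cong)

lemma mod_in_translate_iff:
  assumes "A \<subseteq> {0..<r}"
  shows "y mod r \<in> translate r A t \<longleftrightarrow> (y - t) mod r \<in> A"
proof
  assume "y mod r \<in> translate r A t"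
  then obtain a where a: "a \<in> A" "y mod r = (a + t) mod r" by (auto simp: translate_def)
  then have "(y - t) mod r = (a + t - t) mod r" by (intro mod_diff_cong) auto
  with a assms show "(y - t) mod r \<in> A" by auto
next
  assume "(y - t) mod r \<in> A"
  then show "y mod r \<in> translate r A t"
    unfolding translate_def by (rule rev_image_eqI) (simp add: mod_simps)
qed

text \<open>Since \<open>k\<close> is a unit modulo \<open>r\<close>, every shift is a multiple of
  \<open>k\<close>. Hence every translate of \<open>A\<close> belongs to the family indexed by the
  agenda, including shifts by arbitrary elements of \<open>A\<close>.\<close>

lemma exists_multiple_mod:
  fixes r k t :: int
  assumes "coprime r k" "r > 0"
  shows "\<exists>n::nat. (int n * k) mod r = t mod r"
proof -
  obtain x where x: "[k * x = 1] (mod r)"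
    using assms(1) cong_solve_coprime_int[of k r] by (auto simp: coprime_commute)
  have "int (nat ((x * t) mod r)) = (x * t) mod r" using assms(2) by simp
  then have "(int (nat ((x * t) mod r)) * k) mod r = (x * t * k) mod r"
    by (simp only: mod_mult_left_eq)
  also have "\<dots> = (k * x * t) mod r" by (simp only: mult_ac)
  also have "\<dots> = (1 * t) mod r"
    using x unfolding cong_def by (metis mod_mult_left_eq)
  finally show ?thesis unfolding mult_1 by (rule exI)
qed

text \<open>The injection \<open>e\<close> places the residues among the worlds, so that one
  argument serves both frames: it is \<open>Some\<close> for the first and \<open>id\<close> for the
  second.\<close>

lemma impossibility_frame_translates:
  fixes r k :: int and e :: "int \<Rightarrow> 'w"
  assumes rk: "coprime r k" "1 \<le> k" "3 * k < r"
    and A: "{0, k} \<subseteq> A" "A \<subseteq> {0..k}"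
    and e: "inj e"
    and agenda: "inclusion_agenda W R w0 \<phi> (\<lambda>j. e ` translate r A (int j * k))"
  shows "impossibility_frame W R w0 (\<Union>j. {\<phi> j, neg (\<phi> j)})"
proof -
  let ?B = "\<lambda>j::nat. e ` translate r A (int j * k)"
  interpret inclusion_agenda W R w0 \<phi> ?B by (rule agenda)
  have r: "r > 0" and Ar: "A \<subseteq> {0..<r}" using rk A by auto
  have in_B: "e (y mod r) \<in> ?B j \<longleftrightarrow> (y - int j * k) mod r \<in> A" for y j
    using e mod_in_translate_iff[OF Ar] by (simp add: inj_image_mem_iff)
  \<comment> \<open>An index whose set is the translate by \<open>t\<close>.\<close>
  define m where "m t = (SOME n::nat. (int n * k) mod r = t mod r)" for t
  have m: "(int (m t) * k) mod r = t mod r" for t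
    unfolding m_def using exists_multiple_mod[OF rk(1) r] by (rule someI_ex)
  have main: "path_step W R w0 agenda (\<phi> j) (\<phi> i)" "minimally_connected W R w0 agenda"
    if ij: "int j mod r = (int i + 1) mod r" for i j
  proof -
    let ?t = "int i * k"
    have "(int j * k) mod r = ((int i + 1) * k) mod r" using ij by (metis mod_mult_left_eq)
    then have jk: "(int j * k) mod r = (?t + k) mod r" by (simp add: algebra_simps)
    have in_Bj: "e (y mod r) \<in> ?B j \<longleftrightarrow> (y - (?t + k)) mod r \<in> A" for y
      using in_B mod_diff_cong[OF refl jk] by simp
    have in_Bm: "e (y mod r) \<in> ?B (m s) \<longleftrightarrow> (y - s) mod r \<in> A" for y s
      using in_B mod_diff_cong[OF refl m] by simp
    \<comment> \<open>The translate by \<open>?t + a - k\<close> contains the point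
      \<open>a + ?t\<close>, because \<open>k\<close> lies in \<open>A\<close>. The value
      \<open>a = k\<close> would give back \<open>?B i\<close> itself; its point
      \<open>k + ?t\<close> is left to \<open>?B j\<close>, which contains it because
      \<open>0\<close> lies in \<open>A\<close>.\<close>
    let ?T = "(\<lambda>a. m (?t + a - k)) ` (A - {k})"
    have out: "y mod r \<notin> A" if "k < y" "y < r" for y
      using that A(2) rk(2) by auto
    have fin: "finite ?T" using A(2) finite_subset[of A "{0..k}"] by simp
    have cover: "?B i \<subseteq> ?B j \<union> \<Union> (?B ` ?T)"
    proof
      fix w assume "w \<in> ?B i"
      then obtain a where a: "a \<in> A" "w = e ((a + ?t) mod r)" by (auto simp: translate_def)
      show "w \<in> ?B j \<union> \<Union> (?B ` ?T)"
      proof (cases "a = k")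
        case True
        then show ?thesis using a A in_Bj[of "a + ?t"] by (simp add: algebra_simps)
      next
        case False
        have "e ((a + ?t) mod r) \<in> ?B (m (?t + a - k))"
          unfolding in_Bm using rk A by simp
        then show ?thesis using a False by blast
      qed
    qed
    \<comment> \<open>Relative to such a translate the offset is \<open>y - a + k\<close>. From
      \<open>a < k\<close> and the bounds on \<open>y\<close> it lies above \<open>k\<close> and is
      at most \<open>3 * k\<close>, hence below \<open>r\<close>, and so outside
      \<open>A\<close>.\<close>
    have not_T: "e ((?t + y) mod r) \<notin> \<Union> (?B ` ?T)" if "k \<le> y" "y \<le> 2 * k" for y
    proof
      assume "e ((?t + y) mod r) \<in> \<Union> (?B ` ?T)"
      then obtain a where a: "a \<in> A" "a \<noteq> k" "e ((?t + y) mod r) \<in> ?B (m (?t + a - k))"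
        by blast
      then have "(y - a + k) mod r \<in> A" unfolding in_Bm by (simp add: algebra_simps)
      moreover have "0 \<le> a" "a < k" using a A by force+
      ultimately show False using out[of "y - a + k"] that rk by simp
    qed
    \<comment> \<open>Relative to \<open>?B i\<close> the points \<open>p\<close>, \<open>q\<close>,
      \<open>z\<close> have offsets \<open>k\<close>, \<open>2 * k\<close>, \<open>0\<close>;
      relative to \<open>?B j\<close> they have \<open>0\<close>, \<open>k\<close>,
      \<open>-k\<close>. Modulo \<open>r\<close> the last one is \<open>r - k\<close>, which exceeds
      \<open>k\<close>.\<close>
    have p: "e ((?t + k) mod r) \<in> ?B i" "e ((?t + k) mod r) \<in> ?B j"
      unfolding in_Bj unfolding in_B using A rk by auto
    have q: "e ((?t + 2 * k) mod r) \<in> ?B j" "e ((?t + 2 * k) mod r) \<notin> ?B i"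
      unfolding in_Bj unfolding in_B using A rk out[of "2 * k"] by auto
    have z: "e ((?t + 0) mod r) \<in> ?B i" "e ((?t + 0) mod r) \<notin> ?B j"
      unfolding in_Bj unfolding in_B using A rk out[of "r - k"] by auto
    show "path_step W R w0 agenda (\<phi> j) (\<phi> i)" "minimally_connected W R w0 agenda"
      using path_step_and_connected[OF fin cover p not_T q not_T z] rk by auto
  qed
  have "minimally_connected W R w0 agenda" using main(2)[of 1 0] by simp
  moreover have "strongly_path_connected W R w0 agenda"
    using strongly_path_connected_if_cyclic_steps[OF r] main(1) by blast
  ultimately show ?thesis unfolding impossibility_frame_def agenda_def by blast
qed

section \<open>Agenda formulas and their truth in the first frame\<close>

lemma negation_free_Box_funpow: "negation_free ((Box ^^ j) Var)"
  by (induction j) (auto simp: Box_def Var_def)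

lemma negation_free_Box_Dia_funpow: "negation_free (((Box \<circ> Dia) ^^ j) (Box Var))"
  by (induction j) (auto simp: Box_def Dia_def Var_def)

lemma agenda1_eq: "agenda1 = (\<Union>j. {(Box ^^ Suc j) Var, neg ((Box ^^ Suc j) Var)})"
proof -
  have "{1..} = range Suc" by (auto simp: image_iff Suc_le_eq gr0_conv_Suc)
  then show ?thesis unfolding agenda1_def by (simp only: image_image)
qed

lemma residue_ring_simps:
  "carrier (residue_ring r) = {0..r - 1}" "x \<oplus>\<^bsub>residue_ring r\<^esub> y = (x + y) mod r"
  by (simp_all add: residue_ring_def)

lemma sat_frame1_Box_Some:
  assumes "r > 0" "w \<in> {0..<r}"
  shows "sat (worlds1 r) (rel1 r k A) V (Box \<Phi>) (Some w) \<longleftrightarrow>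
    sat (worlds1 r) (rel1 r k A) V \<Phi> (Some ((w + k) mod r))"
  using assms
  by (auto simp: sat_simps worlds1_def rel1_def residue_ring_simps residue_class_def mod_simps)

lemma sat_frame1_Box_None:
  assumes "A \<subseteq> {0..<r}"
  shows "sat (worlds1 r) (rel1 r k A) V (Box \<Phi>) None \<longleftrightarrow>
    (\<forall>a\<in>A. sat (worlds1 r) (rel1 r k A) V \<Phi> (Some a))"
  using assms by (auto simp: sat_simps worlds1_def rel1_def residue_ring_simps)

lemma sat_frame1_funpow:
  assumes "r > 0" "w \<in> {0..<r}"
  shows "sat (worlds1 r) (rel1 r k A) V ((Box ^^ j) Var) (Some w) \<longleftrightarrow>
    Some ((w + int j * k) mod r) \<in> V"
  using assms(2)
proof (induction j arbitrary: w)
  case 0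
  then show ?case by (simp add: sat_simps)
next
  case (Suc j)
  have "((w + k) mod r + int j * k) mod r = (w + int (Suc j) * k) mod r"
    by (simp add: mod_simps algebra_simps)
  then show ?case using Suc assms(1) by (simp add: sat_frame1_Box_Some)
qed

text \<open>The outermost box leads from the extra world into \<open>A\<close>, and each of the
  other \<open>j\<close> boxes shifts by \<open>k\<close>. So \<open>j + 1\<close> boxes correspond
  to the shift by \<open>j * k\<close>.\<close>

lemma frame1_inclusion_agenda:
  assumes "r > 0" "A \<subseteq> {0..<r}"
  shows "inclusion_agenda (worlds1 r) (rel1 r k A) None (\<lambda>j. (Box ^^ Suc j) Var)
    (\<lambda>j. Some ` translate r A (int j * k))"
proof
  fix V :: "int option set" and j
  have "sat (worlds1 r) (rel1 r k A) V ((Box ^^ Suc j) Var) None \<longleftrightarrow>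
    (\<forall>a\<in>A. sat (worlds1 r) (rel1 r k A) V ((Box ^^ j) Var) (Some a))"
    using assms(2) by (simp add: sat_frame1_Box_None)
  also have "\<dots> \<longleftrightarrow> (\<forall>a\<in>A. Some ((a + int j * k) mod r) \<in> V)"
    using assms by (intro ball_cong refl sat_frame1_funpow) auto
  also have "\<dots> \<longleftrightarrow> Some ` translate r A (int j * k) \<subseteq> V" by (auto simp: translate_def)
  finally show "sat (worlds1 r) (rel1 r k A) V ((Box ^^ Suc j) Var) None \<longleftrightarrow>
    Some ` translate r A (int j * k) \<subseteq> V" .
next
  show "Some ` translate r A (int j * k) \<subseteq> worlds1 r" for j
    using assms(1) by (auto simp: translate_def worlds1_def residue_ring_simps)
qed (rule negation_free_Box_funpow)

section \<open>Truth in the second frame, where symmetry of \<open>A\<close> enters\<close>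

lemma sat_frame2_Box:
  assumes "r > 0" "w \<in> {0..<r}"
  shows "sat (worlds2 r) (rel2 r A) V (Box \<Phi>) w \<longleftrightarrow>
    (\<forall>a\<in>A. sat (worlds2 r) (rel2 r A) V \<Phi> ((w + a) mod r))"
  using assms by (auto simp: sat_simps worlds2_def rel2_def residue_ring_simps)

lemma sat_frame2_Dia:
  assumes "r > 0" "w \<in> {0..<r}"
  shows "sat (worlds2 r) (rel2 r A) V (Dia \<Phi>) w \<longleftrightarrow>
    (\<exists>a\<in>A. sat (worlds2 r) (rel2 r A) V \<Phi> ((w + a) mod r))"
  using assms by (auto simp: sat_simps worlds2_def rel2_def residue_ring_simps)

text \<open>A pair of box and diamond adds \<open>k\<close> to the shift: the successor
  \<open>a\<close> chosen by the box can be answered by \<open>b = k - a\<close>, and conversely any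
  answers \<open>b\<close> together cover the translate by the larger shift.\<close>

lemma sat_frame2_funpow:
  assumes r: "r > 0" and sym: "\<And>a. a \<in> A \<Longrightarrow> k - a \<in> A" and w: "w \<in> {0..<r}"
  shows "sat (worlds2 r) (rel2 r A) V (((Box \<circ> Dia) ^^ j) (Box Var)) w \<longleftrightarrow>
    translate r A (w + int j * k) \<subseteq> V"
  using w
proof (induction j arbitrary: w)
  case 0
  then show ?case using r by (auto simp: sat_frame2_Box sat_simps(1) translate_def add.commute)
next
  case (Suc j)
  let ?sat = "sat (worlds2 r) (rel2 r A) V"
  \<comment> \<open>The induction hypothesis speaks about reduced worlds; this removes the inner
    reductions.\<close>
  have "translate r A (((w + a) mod r + b) mod r + int j * k) =
      translate r A (w + a + b + int j * k)" for a b
    by (rule translate_cong) (simp add: mod_simps)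
  moreover define \<Phi> where "\<Phi> = ((Box \<circ> Dia) ^^ j) (Box Var)"
  moreover have "((Box \<circ> Dia) ^^ Suc j) (Box Var) = Box (Dia \<Phi>)" by (simp add: \<Phi>_def)
  ultimately have "?sat (((Box \<circ> Dia) ^^ Suc j) (Box Var)) w \<longleftrightarrow>
      (\<forall>a\<in>A. \<exists>b\<in>A. translate r A (w + a + b + int j * k) \<subseteq> V)"
    using r Suc.prems Suc.IH[folded \<Phi>_def] by (simp add: sat_frame2_Box sat_frame2_Dia)
  also have "\<dots> \<longleftrightarrow> translate r A (w + int (Suc j) * k) \<subseteq> V"
  proof
    assume *: "\<forall>a\<in>A. \<exists>b\<in>A. translate r A (w + a + b + int j * k) \<subseteq> V"
    show "translate r A (w + int (Suc j) * k) \<subseteq> V"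
    proof
      fix v assume "v \<in> translate r A (w + int (Suc j) * k)"
      then obtain c where c: "c \<in> A" "v = (c + (w + int (Suc j) * k)) mod r"
        by (auto simp: translate_def)
      \<comment> \<open>The offset \<open>c\<close> of the point itself is used as the box
        successor. Whatever \<open>b\<close> answers it, symmetry puts \<open>k - b\<close> in
        \<open>A\<close>, and this element of the translate lands exactly on
        \<open>v\<close>.\<close>
      then obtain b where b: "b \<in> A" "translate r A (w + c + b + int j * k) \<subseteq> V"
        using * by blast
      have "v = ((k - b) + (w + c + b + int j * k)) mod r"
        using c by (simp add: algebra_simps)
      then show "v \<in> V" using b sym[OF b(1)] by (auto simp: translate_def)
    qed
  next
    assume *: "translate r A (w + int (Suc j) * k) \<subseteq> V"
    show "\<forall>a\<in>A. \<exists>b\<in>A. translate r A (w + a + b + int j * k) \<subseteq> V"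
    proof
      fix a assume "a \<in> A"
      moreover have "w + a + (k - a) + int j * k = w + int (Suc j) * k"
        by (simp add: algebra_simps)
      ultimately show "\<exists>b\<in>A. translate r A (w + a + b + int j * k) \<subseteq> V"
        using * sym by metis
    qed
  qed
  finally show ?case .
qed

lemma frame2_inclusion_agenda:
  assumes "r > 0" "\<And>a. a \<in> A \<Longrightarrow> k - a \<in> A"
  shows "inclusion_agenda (worlds2 r) (rel2 r A) 0 (\<lambda>j. ((Box \<circ> Dia) ^^ j) (Box Var))
    (\<lambda>j. id ` translate r A (int j * k))"
proof
  show "sat (worlds2 r) (rel2 r A) V (((Box \<circ> Dia) ^^ j) (Box Var)) 0 \<longleftrightarrow>
    id ` translate r A (int j * k) \<subseteq> V" for V j
    using sat_frame2_funpow[OF assms, of 0] assms(1) by simp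
  show "id ` translate r A (int j * k) \<subseteq> worlds2 r" for j
    using assms(1) by (auto simp: translate_def worlds2_def residue_ring_simps)
qed (rule negation_free_Box_Dia_funpow)

text \<open>As \<open>0 \<le> a \<le> k < r\<close>, subtraction in the residue ring does not wrap
  around and agrees with integer subtraction.\<close>

lemma k_symmetricD:
  assumes sym: "k_symmetric r k A" and A: "A \<subseteq> {0..k}" "k < r" "r > 1" and a: "a \<in> A"
  shows "k - a \<in> A"
proof -
  interpret residues r "residue_ring r" using A by unfold_locales auto
  have "residue_class r k \<ominus>\<^bsub>residue_ring r\<^esub> a = (k - a) mod r"
    by (simp add: a_minus_def res_neg_eq residue_ring_simps residue_class_def mod_simps)
  moreover have "(k - a) mod r = k - a" using A a by (intro mod_pos_pos_trivial) auto
  ultimately show ?thesis using sym a unfolding k_symmetric_def by metis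
qed

theorem theorem3:
  fixes r k :: int and A :: "int set"
  assumes "coprime r k"
    and "1 \<le> k"
    and "real_of_int k < real_of_int r / 3"
    and "{residue_class r 0, residue_class r k} \<subseteq> A"
    and "A \<subseteq> residue_interval r 0 k"
  shows "impossibility_frame (worlds1 r) (rel1 r k A) None agenda1 \<and>
    (k_symmetric r k A \<longrightarrow> impossibility_frame (worlds2 r) (rel2 r A) (residue_class r 0) agenda2)"
proof -
  have kr: "3 * k < r" using assms(3) by linarith
  have A: "{0, k} \<subseteq> A" "A \<subseteq> {0..k}" "A \<subseteq> {0..<r}"
    using assms(2,4,5) kr by (auto simp: residue_class_def residue_interval_def)
  have r: "r > 0" using assms(2) kr by linarith
  note translates = impossibility_frame_translates[OF assms(1,2) kr A(1,2)]
  have "impossibility_frame (worlds1 r) (rel1 r k A) None agenda1"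
    unfolding agenda1_eq by (rule translates[OF _ frame1_inclusion_agenda[OF r A(3)]]) simp
  moreover have "impossibility_frame (worlds2 r) (rel2 r A) (residue_class r 0) agenda2"
    if "k_symmetric r k A"
  proof -
    have "k - a \<in> A" if "a \<in> A" for a
      using k_symmetricD[OF \<open>k_symmetric r k A\<close> A(2) _ _ that] kr assms(2) by linarith
    from translates[OF inj_on_id frame2_inclusion_agenda[OF r this]] show ?thesis
      by (simp add: agenda2_def residue_class_def)
  qed
  ultimately show ?thesis by blast
qed

end
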